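(* Let $d\ge 1$, let $S\subset\mathbb R^d$ be a regular simplex of unit side length, let $P\subseteq S$ be a convex body of diameter $1$, and let $0<\varepsilon<1$. Then there exist a nested barycentric system $B_t$ on $S$, obtained by always placing each new split point at the barycenter of the simplex of the current triangulation that contains it, and a weight vector $\vec w=(w_0,\dots,w_t)$ with entries in $\mathbb R\cup\{-\infty\}$, such that the set $$\tilde P=\{\vec x\in S:\ \vec w\cdot\phi_t(\vec x)\ge 0\}$$ satisfies: (1) $\operatorname{vol}(\tilde P\setminus P)<\varepsilon\operatorname{vol}(S)$; (2) $\tilde P^{(-\varepsilon)}\subseteq P\subseteq\tilde P$.
   Context: Nested barycentric system on a $d$-simplex $S\subset\mathbb R^d$ with vertices $q_0,\dots,q_d$: an ordered list of points $B_t=(q_0,\dots,q_t)$, $t\ge d$, together with a triangulation $\mathcal T_t$ of $S$, defined recursively. $B_d=(q_0,\dots,q_d)$ with $\mathcal T_d=\{S\}$. Given $B_{j}$ and $\mathcal T_{j}$, a point $q_{j+1}$ is chosen in the interior of some simplex $T\in\mathcal T_{j}$ with vertices $v_0,\dots,v_d$; then $\mathcal T_{j+1}$ is obtained from $\mathcal T_j$ by replacing $T$ with the $d+1$ simplices obtained from $T$ by replacing one vertex $v_m$ by $q_{j+1}$ ($m=0,\dots,d$), and $B_{j+1}=(q_0,\dots,q_{j+1})$. The embedding $\phi_t:S\to\mathbb R^{t+1}$ is defined as follows: if $\vec x$ lies in a simplex $T\in\mathcal T_t$ with vertices $q_{i_0},\dots,q_{i_d}$ and $\vec x=\sum_{m=0}^d\alpha_m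 q_{i_m}$ with $\alpha_m\ge 0$, $\sum_m\alpha_m=1$ (barycentric coordinates), then $\phi_t(\vec x)_{i_m}=\alpha_m$ for $m=0,\dots,d$ and all other coordinates of $\phi_t(\vec x)$ are $0$ (this is independent of the choice of $T$ when $\vec x$ lies on a common face). Weights may equal $-\infty$, with the conventions $(-\infty)\cdot 0=0$ and $(-\infty)\cdot a=-\infty$ for $a>0$, and sums containing $-\infty$ (and otherwise finite terms) equal to $-\infty$. For $X\subseteq\mathbb R^d$ and $\varepsilon>0$, $X^{(-\varepsilon)}=\{p\in X: B_\varepsilon(p)\subseteq X\}$, where $B_\varepsilon(p)$ is the closed Euclidean ball of radius $\varepsilon$ around $p$. $\operatorname{vol}$ is $d$-dimensional Lebesgue measure. The barycenter of a simplex with vertices $p_0,\dots,p_d$ is $(p_0+\dots+p_d)/(d+1)$. *)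

theory Defs
  imports "HOL-Analysis.Analysis"
begin

text \<open>A triangulation is a set of simplices, each given by the set of indices of its
 d+1 vertices among the points q 0, q 1, ... . The dimension is d = DIM('a).\<close>

definition barycenter_idx :: "(nat \<Rightarrow> 'a::euclidean_space) \<Rightarrow> nat set \<Rightarrow> 'a" where
  "barycenter_idx q V = (\<Sum>i\<in>V. q i) /\<^sub>R real (card V)"

definition split_simplex :: "nat set set \<Rightarrow> nat set \<Rightarrow> nat \<Rightarrow> nat set set" where
  "split_simplex T V k = (T - {V}) \<union> {insert k (V - {m}) | m. m \<in> V}"

text \<open>Nested barycentric system in which every new point is the barycenter of the
 simplex of the current triangulation that contains it.
 bary_nbs q t T: B_t = (q 0, ..., q t) with triangulation T.\<close>
inductive bary_nbs :: "(nat \<Rightarrow> 'a::euclidean_space) \<Rightarrow> nat \<Rightarrow> nat set set \<Rightarrow> bool"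
  for q where
  base: "bary_nbs q DIM('a) {{0..DIM('a)}}"
| step: "\<lbrakk> bary_nbs q j T; V \<in> T;
           q (Suc j) \<in> interior (convex hull (q ` V));
           q (Suc j) = barycenter_idx q V \<rbrakk>
         \<Longrightarrow> bary_nbs q (Suc j) (split_simplex T V (Suc j))"

definition bary_coords :: "(nat \<Rightarrow> 'a::euclidean_space) \<Rightarrow> nat set \<Rightarrow> 'a \<Rightarrow> nat \<Rightarrow> real" where
  "bary_coords q V x = (THE \<alpha>. (\<forall>i. i \<notin> V \<longrightarrow> \<alpha> i = 0) \<and> (\<forall>i\<in>V. 0 \<le> \<alpha> i)
       \<and> sum \<alpha> V = 1 \<and> (\<Sum>i\<in>V. \<alpha> i *\<^sub>R q i) = x)"

definition phi :: "(nat \<Rightarrow> 'a::euclidean_space) \<Rightarrow> nat set set \<Rightarrow> 'a \<Rightarrow> nat \<Rightarrow> real" where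
  "phi q T x = (if \<exists>V\<in>T. x \<in> convex hull (q ` V)
      then bary_coords q (SOME V. V \<in> T \<and> x \<in> convex hull (q ` V)) x
      else (\<lambda>_. 0))"

definition inner_parallel :: "'a::metric_space set \<Rightarrow> real \<Rightarrow> 'a set" where
  "inner_parallel X e = {p \<in> X. cball p e \<subseteq> X}"

end

theory Submission
  imports Defs
begin

text \<open>Let spread V be the sum of the squared distances between the vertices of a cell V. Splitting V
at its barycenter into n = d + 1 children of equal volume multiplies the average spread by
1 - 1/n - 1/n^2. Hence, although the edges of S are never subdivided, repeatedly splitting all cells
makes the sum of volume times spread arbitrarily small, so that all cells outside a set of small
volume have small diameter. Now split every cell once more, and give a new vertex the weight
-\<infinity> if the cell it splits misses P; all other weights are 0. Then P is contained in Pt, and up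
to a null set every point of Pt lies in a cell meeting P of the last but one triangulation: it is
close to P or belongs to a cell of large diameter. So Pt - P has small volume. Finally, if the ball
of radius \<epsilon> around a point outside P were contained in Pt, then by convexity Pt - P would contain
a ball of radius \<epsilon>/2, which is too large.\<close>

section \<open>Linear involutions preserve Lebesgue measure\<close>

lemma nn_integral_lborel_reflect:
  fixes f :: "'a::euclidean_space \<Rightarrow> ennreal"
  assumes [measurable]: "f \<in> borel_measurable borel"
  shows "(\<integral>\<^sup>+x. f (c - x) \<partial>lborel) = (\<integral>\<^sup>+x. f x \<partial>lborel)"
proof -
  have "(lborel :: 'a measure) = distr lborel borel (\<lambda>x. c + (-1) *\<^sub>R x)"
    using lborel_affine[of "-1" c] by (simp add: density_1)
  then have "(\<integral>\<^sup>+x. f x \<partial>lborel) = (\<integral>\<^sup>+x. f x \<partial>distr lborel borel (\<lambda>x. c + (-1) *\<^sub>R x))"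
    by simp
  also have "\<dots> = (\<integral>\<^sup>+x. f (c - x) \<partial>lborel)"
    by (subst nn_integral_distr) auto
  finally show ?thesis by simp
qed

lemma nn_integral_lborel_shift:
  fixes f :: "'a::euclidean_space \<Rightarrow> ennreal"
  assumes [measurable]: "f \<in> borel_measurable borel"
  shows "(\<integral>\<^sup>+x. f (x - c) \<partial>lborel) = (\<integral>\<^sup>+x. f x \<partial>lborel)"
proof -
  have "(\<integral>\<^sup>+x. f x \<partial>lborel) = (\<integral>\<^sup>+x. f x \<partial>distr lborel borel ((+) (-c)))"
    by (simp add: lborel_distr_plus)
  also have "\<dots> = (\<integral>\<^sup>+x. f (x - c) \<partial>lborel)"
    by (subst nn_integral_distr) auto
  finally show ?thesis by simp
qed

text \<open>The image of Lebesgue measure under a linear bijection is translation invariant, and the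
  Fubini argument for uniqueness of such measures shows that it is a multiple of Lebesgue measure;
  for an involution the factor squares to 1.\<close>

lemma emeasure_lborel_linear_involution:
  fixes g :: "'a::euclidean_space \<Rightarrow> 'a"
  assumes g: "linear g" and inv: "\<And>x. g (g x) = x" and A[measurable]: "A \<in> sets borel"
    and fin: "emeasure lborel A < \<infinity>"
  shows "emeasure lborel (g -` A) = emeasure lborel A"
proof -
  interpret g: linear g by (fact g)
  have [measurable]: "g \<in> borel_measurable borel"
    by (intro borel_measurable_continuous_onI linear_continuous_on) (simp add: g linear_conv_bounded_linear[symmetric])
  define i where "i = (indicator A :: 'a \<Rightarrow> ennreal)"
  define j where "j = (indicator (g -` A) :: 'a \<Rightarrow> ennreal)"
  have B[measurable]: "g -` A \<in> sets borel"
    using measurable_sets[of g borel borel A] by simp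
  have [measurable]: "i \<in> borel_measurable borel" "j \<in> borel_measurable borel"
    by (simp_all add: i_def j_def)
  have ij: "j (g y) = i y" "i (g y) = j y" for y
    by (auto simp: i_def j_def indicator_def inv)
  \<comment> \<open>The same double integral is evaluated in two ways. Shifting \<open>y\<close> by
    \<open>g x\<close> turns \<open>g y\<close> into \<open>g y - x\<close>, reflecting
    \<open>x\<close> about \<open>g y\<close> interchanges the arguments of \<open>i\<close> and
    \<open>j\<close>, and a second shift of \<open>y\<close> separates the variables again, now with
    the preimage in place of \<open>A\<close>.\<close>
  have "emeasure lborel A * emeasure lborel A = (\<integral>\<^sup>+x. \<integral>\<^sup>+y. i x * j (g y) \<partial>lborel \<partial>lborel)"
    by (simp add: ij nn_integral_cmult nn_integral_multc) (simp add: i_def)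
  also have "\<dots> = (\<integral>\<^sup>+x. \<integral>\<^sup>+y. i x * j (g y - x) \<partial>lborel \<partial>lborel)"
  proof (rule nn_integral_cong)
    fix x
    show "(\<integral>\<^sup>+y. i x * j (g y) \<partial>lborel) = (\<integral>\<^sup>+y. i x * j (g y - x) \<partial>lborel)"
      using nn_integral_lborel_shift[of "\<lambda>y. i x * j (g y)" "g x"] by (simp add: g.diff inv)
  qed
  also have "\<dots> = (\<integral>\<^sup>+y. \<integral>\<^sup>+x. i x * j (g y - x) \<partial>lborel \<partial>lborel)"
    by (rule lborel_pair.Fubini'[symmetric]) simp
  also have "\<dots> = (\<integral>\<^sup>+y. \<integral>\<^sup>+x. i (g y - x) * j x \<partial>lborel \<partial>lborel)"
  proof (rule nn_integral_cong)
    fix y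
    show "(\<integral>\<^sup>+x. i x * j (g y - x) \<partial>lborel) = (\<integral>\<^sup>+x. i (g y - x) * j x \<partial>lborel)"
      using nn_integral_lborel_reflect[of "\<lambda>x. i x * j (g y - x)" "g y"] by simp
  qed
  also have "\<dots> = (\<integral>\<^sup>+x. \<integral>\<^sup>+y. i (g y - x) * j x \<partial>lborel \<partial>lborel)"
    by (rule lborel_pair.Fubini') simp
  also have "\<dots> = (\<integral>\<^sup>+x. \<integral>\<^sup>+y. i (g y) * j x \<partial>lborel \<partial>lborel)"
  proof (rule nn_integral_cong)
    fix x
    show "(\<integral>\<^sup>+y. i (g y - x) * j x \<partial>lborel) = (\<integral>\<^sup>+y. i (g y) * j x \<partial>lborel)"
      using nn_integral_lborel_shift[of "\<lambda>y. i (g y) * j x" "g x"] by (simp add: g.diff inv)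
  qed
  also have "\<dots> = emeasure lborel (g -` A) * emeasure lborel (g -` A)"
    by (simp add: ij nn_integral_cmult nn_integral_multc) (simp add: j_def)
  finally have eq: "emeasure lborel A * emeasure lborel A = emeasure lborel (g -` A) * emeasure lborel (g -` A)" .
  obtain a where a: "emeasure lborel A = ennreal a" "a \<ge> 0"
    using fin by (cases "emeasure lborel A") auto
  show ?thesis
  proof (cases "emeasure lborel (g -` A)")
    case (real b)
    then have "a * a = b * b"
      using eq a by (simp flip: ennreal_mult)
    then show ?thesis
      using real a by (metis abs_of_nonneg real_sqrt_abs2)
  next
    case top
    then show ?thesis
      using eq a by (simp flip: ennreal_mult)
  qed
qed

text \<open>As \<open>g\<close> is its own inverse, images under \<open>g\<close> are preimages, and
  the translation leaves the measure unchanged. Compactness supplies both Borel measurability and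
  finite measure.\<close>

lemma measure_affine_involution_image:
  fixes g :: "'a::euclidean_space \<Rightarrow> 'a"
  assumes g: "linear g" and inv: "\<And>x. g (g x) = x" and A: "compact A"
  shows "measure lebesgue ((\<lambda>x. c + g x) ` A) = measure lebesgue A"
proof -
  have im: "g ` A = g -` A"
  proof (intro equalityI subsetI)
    fix x assume "x \<in> g -` A"
    then have "g (g x) \<in> g ` A" by blast
    then show "x \<in> g ` A" by (simp add: inv)
  qed (auto simp: inv)
  have "compact (g ` A)"
    using A g by (intro compact_continuous_image linear_continuous_on) (simp_all add: linear_conv_bounded_linear)
  have "measure lebesgue ((\<lambda>x. c + g x) ` A) = measure lebesgue ((+) c ` (g ` A))"
    by (simp add: image_image)
  also have "\<dots> = measure lebesgue (g ` A)"
    by (rule measure_translation)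
  also have "\<dots> = measure lborel (g ` A)"
    using borel_compact[OF \<open>compact (g ` A)\<close>] by (intro measure_completion) (simp only: sets_lborel)
  also have "\<dots> = measure lborel A"
  proof -
    have "emeasure lborel (g -` A) = emeasure lborel A"
      by (rule emeasure_lborel_linear_involution[OF g inv borel_compact[OF A]
            emeasure_bounded_finite[OF compact_imp_bounded[OF A]]])
    then show ?thesis by (simp only: im measure_def)
  qed
  also have "\<dots> = measure lebesgue A"
    using borel_compact[OF A] by (intro measure_completion[symmetric]) (simp only: sets_lborel)
  finally show ?thesis .
qed

text \<open>Solving the barycenter equation for \<open>a\<close> expresses \<open>a\<close> through
  the barycenter and the other points. Inserting an affine combination \<open>u\<close> of those
  points for the barycenter gives coefficients \<open>n * u x - 1\<close>, whose sum is n - (n - 1)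
  = 1.\<close>

lemma vertex_in_affine_hull_if_barycenter:
  fixes A :: "'a::euclidean_space set"
  assumes "finite A" "a \<in> A" and b: "(\<Sum>x\<in>A. x) /\<^sub>R real (card A) \<in> affine hull (A - {a})"
  shows "a \<in> affine hull (A - {a})"
proof -
  define b where "b = (\<Sum>x\<in>A. x) /\<^sub>R real (card A)"
  define n where "n = real (card A)"
  have n0: "n > 0" using assms by (auto simp: n_def card_gt_0_iff)
  have s: "(\<Sum>x\<in>A. x) = n *\<^sub>R b"
    using n0 by (simp add: b_def n_def)
  obtain u where u: "sum u (A - {a}) = 1" "(\<Sum>x\<in>A - {a}. u x *\<^sub>R x) = b"
    using b assms(1) by (auto simp: affine_hull_finite b_def)
  have "(\<Sum>x\<in>A - {a}. (n * u x - 1) *\<^sub>R x) = n *\<^sub>R b - (\<Sum>x\<in>A - {a}. x)"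
    by (simp add: scaleR_diff_left sum_subtractf scaleR_sum_right flip: u(2))
  also have "\<dots> = a"
    using assms by (simp add: s[symmetric] sum.remove[of A a])
  moreover have "(\<Sum>x\<in>A - {a}. (n * u x - 1)) = 1"
    using u(1) n0 assms by (simp add: sum_subtractf flip: sum_distrib_left) (simp add: n_def of_nat_diff Suc_le_eq card_gt_0_iff)
  ultimately show ?thesis
    using assms(1) by (auto simp: affine_hull_finite intro!: exI[of _ "\<lambda>x. n * u x - 1"])
qed

section \<open>Barycentric splitting of a simplex\<close>

text \<open>At most d points span an affine space of dimension below d, so the hull has empty
  interior, and a convex set with empty interior is null.\<close>

lemma negligible_convex_hull_card:
  fixes A :: "'a::euclidean_space set"
  assumes "finite A" "card A \<le> DIM('a)"
  shows "negligible (convex hull A)"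
proof -
  have "aff_dim (convex hull A) < DIM('a)"
    using aff_dim_le_card[OF assms(1)] assms(2) by (simp add: aff_dim_convex_hull)
  then show ?thesis
    using aff_dim_nonempty_interior[of "convex hull A"] negligible_convex_interior[of "convex hull A"]
    by (auto simp: convex_convex_hull)
qed

text \<open>The geometry of one split is developed for vertex sets, the form in which facts about
  convex hulls are stated; the locale \<open>splitting\<close> transfers it to index sets.\<close>

locale nondegenerate_simplex =
  fixes A :: "'a::euclidean_space set" and b :: 'a
  assumes indep: "\<not> affine_dependent A" and card_A: "card A = Suc DIM('a)"
    and b_def: "b = (\<Sum>x\<in>A. x) /\<^sub>R real (card A)"
begin

lemma finite_A: "finite A"
  using indep by (rule aff_independent_finite)

lemma barycenter_in_interior: "b \<in> interior (convex hull A)"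
proof -
  have "(\<Sum>x\<in>A. (1 / real (card A)) *\<^sub>R x) = b"
    by (simp add: b_def scaleR_sum_right divide_inverse)
  moreover have "(\<Sum>x\<in>A. 1 / real (card A)) = 1"
    using card_A by simp
  ultimately show ?thesis
    unfolding interior_convex_hull_explicit[OF indep] using card_A
    by (auto intro!: exI[of _ "\<lambda>_. 1 / real (card A)"])
qed

lemma barycenter_in_hull: "b \<in> convex hull A"
  using barycenter_in_interior interior_subset by blast

lemma barycenter_notin_affine_hull:
  assumes "a \<in> A" shows "b \<notin> affine hull (A - {a})"
  using vertex_in_affine_hull_if_barycenter[OF finite_A assms] indep assms
  by (auto simp: b_def affine_dependent_def)

lemma barycenter_notin: "b \<notin> A"
proof
  assume "b \<in> A"
  have "card A > 1" using card_A by simp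
  then have "\<not> card A \<le> Suc 0" by simp
  then obtain a where "a \<in> A" "a \<noteq> b"
    unfolding card_le_Suc0_iff_eq[OF finite_A] by blast
  with \<open>b \<in> A\<close> have "b \<in> affine hull (A - {a})"
    by (intro hull_inc) auto
  with \<open>a \<in> A\<close> show False
    using barycenter_notin_affine_hull by blast
qed

lemma child_independent:
  assumes "a \<in> A" shows "\<not> affine_dependent (insert b (A - {a}))"
  using affine_independent_insert[OF affine_independent_subset[OF indep] barycenter_notin_affine_hull[OF assms]]
  by auto

lemma child_subset:
  assumes "a \<in> A" shows "convex hull (insert b (A - {a})) \<subseteq> convex hull A"
  using barycenter_in_hull by (intro hull_minimal) (auto intro: hull_inc)

lemma children_Union: "convex hull A = (\<Union>a\<in>A. convex hull (insert b (A - {a})))"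
  by (rule convex_hull_exchange_Union) (rule barycenter_in_hull)

text \<open>By uniqueness of convex representations, two children meet only in the hull of
  \<open>b\<close> and their common old vertices. These are at most d points.\<close>

lemma children_overlap:
  assumes "a \<in> A" "a' \<in> A" "a \<noteq> a'"
  shows "negligible (convex hull (insert b (A - {a})) \<inter> convex hull (insert b (A - {a'})))"
proof (rule negligible_subset)
  show "convex hull (insert b (A - {a})) \<inter> convex hull (insert b (A - {a'}))
      \<subseteq> convex hull (insert b ((A - {a}) \<inter> (A - {a'})))"
    using in_convex_hull_exchange_unique[OF indep barycenter_in_hull Diff_subset Diff_subset]
    by (intro subsetI) (elim IntE)
  have "(A - {a}) \<inter> (A - {a'}) = A - {a, a'}" by auto
  moreover have "card (A - {a, a'}) = DIM('a) - 1"
    using assms card_A finite_A by (simp add: card_Diff_subset)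
  ultimately show "negligible (convex hull (insert b ((A - {a}) \<inter> (A - {a'}))))"
    using finite_A by (intro negligible_convex_hull_card) (auto simp: card_insert_if)
qed

text \<open>An affine involution exchanges two vertices and fixes the others, hence the barycenter.\<close>

lemma measure_child_eq:
  assumes a: "a \<in> A" "a' \<in> A" "a \<noteq> a'"
  shows "measure lebesgue (convex hull (insert b (A - {a}))) =
         measure lebesgue (convex hull (insert b (A - {a'})))"
proof -
  \<comment> \<open>The mirror is a hyperplane through the midpoint of \<open>a\<close> and
    \<open>a'\<close> and the other d - 1 vertices; it exists because these are at most d
    points.\<close>
  define m where "m = (1/2) *\<^sub>R (a + a')"
  have fin: "finite (insert m (A - {a, a'}))" using finite_A by auto
  have "card (insert m (A - {a, a'})) \<le> DIM('a)"
    using a card_A finite_A by (auto simp: card_insert_if card_Diff_subset)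
  then have "aff_dim (insert m (A - {a, a'})) < DIM('a)"
    using aff_dim_le_card[OF fin] by linarith
  then obtain n \<beta> where n: "n \<noteq> 0" "insert m (A - {a, a'}) \<subseteq> {x. n \<bullet> x = \<beta>}"
    by (rule aff_lowdim_subset_hyperplane)
  define k where "k = n \<bullet> a - \<beta>"
  have rest: "n \<bullet> x = \<beta>" if "x \<in> A" "x \<noteq> a" "x \<noteq> a'" for x
    using n that by auto
  have "n \<bullet> m = \<beta>" using n by auto
  then have a': "n \<bullet> a' = \<beta> - k"
    by (simp add: m_def k_def inner_add_right field_simps)
  have k: "k \<noteq> 0"
  proof
    assume "k = 0"
    then have "A \<subseteq> {x. n \<bullet> x = \<beta>}"
      using rest a' by (auto simp: k_def)
    then have "convex hull A \<subseteq> {x. n \<bullet> x = \<beta>}"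
      by (simp add: convex_hyperplane hull_minimal)
    then have "interior (convex hull A) \<subseteq> interior {x. n \<bullet> x = \<beta>}"
      by (rule interior_mono)
    then show False
      using barycenter_in_interior n by (auto simp: interior_hyperplane)
  qed
  \<comment> \<open>The involution is the oblique reflection in this hyperplane along
    \<open>a' - a\<close>, separated into its linear part \<open>g\<close> and the translation
    \<open>c\<close>. The scaling by \<open>k\<close> makes it send \<open>a\<close> to
    \<open>a'\<close>.\<close>
  define g where "g x = x + ((n \<bullet> x) / k) *\<^sub>R (a' - a)" for x
  define c where "c = - (\<beta> / k) *\<^sub>R (a' - a)"
  have f: "c + g x = x + ((n \<bullet> x - \<beta>) / k) *\<^sub>R (a' - a)" for x
    by (simp add: c_def g_def diff_divide_distrib scaleR_diff_left)
  have g: "linear g"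
    by (intro linearI) (simp_all add: g_def inner_add_right algebra_simps add_divide_distrib)
  have ng: "n \<bullet> (a' - a) = - 2 * k"
    using a' by (simp add: inner_diff_right k_def)
  have inv: "g (g x) = x" for x
  proof -
    have "n \<bullet> g x = - (n \<bullet> x)"
      using k by (simp add: g_def inner_add_right ng)
    then show ?thesis
      by (simp add: g_def[of "g x"]) (simp add: g_def)
  qed
  have fa: "c + g a = a'" "c + g a' = a"
    using k by (simp_all add: f a') (simp_all add: k_def)
  have fx: "c + g x = x" if "x \<in> A" "x \<noteq> a" "x \<noteq> a'" for x
    using rest[OF that] by (simp add: f)
  \<comment> \<open>The values of the functional at \<open>a\<close> and \<open>a'\<close> are
    \<beta> + k and \<beta> - k, so they average to \<beta> like all the others. Hence the
    barycenter lies on the mirror and is fixed.\<close>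
  have "(\<Sum>x\<in>A. n \<bullet> x) = real (card A) * \<beta>"
  proof -
    have "(\<Sum>x\<in>A. n \<bullet> x) = n \<bullet> a + (n \<bullet> a' + (\<Sum>x\<in>A - {a} - {a'}. n \<bullet> x))"
      using a finite_A by (subst sum.remove[of _ a], simp, simp, subst sum.remove[of _ a'], auto)
    also have "(\<Sum>x\<in>A - {a} - {a'}. n \<bullet> x) = (\<Sum>x\<in>A - {a} - {a'}. \<beta>)"
      using rest by (intro sum.cong) auto
    also have "\<dots> = real (card A - 2) * \<beta>"
      using a finite_A by (simp add: numeral_2_eq_2)
    also have "n \<bullet> a + (n \<bullet> a' + real (card A - 2) * \<beta>) = real (card A) * \<beta>"
      using a' DIM_positive[where 'a='a] by (simp add: card_A k_def of_nat_diff algebra_simps)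
    finally show ?thesis .
  qed
  then have "n \<bullet> b = \<beta>"
    using card_A by (simp add: b_def inner_sum_right)
  then have fb: "c + g b = b" by (simp add: f)
  have "(\<lambda>x. c + g x) ` insert b (A - {a}) = insert b (A - {a'})"
  proof -
    have "insert b (A - {a}) = insert b (insert a' (A - {a, a'}))"
         "insert b (A - {a'}) = insert b (insert a (A - {a, a'}))"
      using a by auto
    moreover have "(\<lambda>x. c + g x) ` (A - {a, a'}) = A - {a, a'}"
      using fx by (intro trans[OF image_cong[OF refl] image_ident]) auto
    ultimately show ?thesis
      using fa fb by (simp add: image_insert)
  qed
  moreover have "(\<lambda>x. c + g x) ` X = (+) c ` (g ` X)" for X
    by (simp add: image_image)
  then have "(\<lambda>x. c + g x) ` (convex hull X) = convex hull ((\<lambda>x. c + g x) ` X)" for X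
    by (simp only: convex_hull_linear_image[OF g] convex_hull_translation)
  ultimately have "(\<lambda>x. c + g x) ` (convex hull (insert b (A - {a}))) = convex hull (insert b (A - {a'}))"
    by simp
  moreover have "compact (convex hull (insert b (A - {a})))"
    using finite_A by (intro compact_convex_hull finite_imp_compact) auto
  ultimately show ?thesis
    using measure_affine_involution_image[OF g inv, of "convex hull (insert b (A - {a}))" c] by simp
qed

text \<open>The children cover the simplex, overlap in null sets and all have the same
  volume.\<close>

lemma measure_child:
  assumes "a \<in> A"
  shows "measure lebesgue (convex hull (insert b (A - {a}))) = measure lebesgue (convex hull A) / real (card A)"
proof -
  have "measure lebesgue (convex hull A) = (\<Sum>x\<in>A. measure lebesgue (convex hull (insert b (A - {x}))))"
    unfolding children_Union
    using finite_A children_overlap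
    by (intro measure_negligible_finite_Union_image lmeasurable_compact compact_convex_hull)
       (auto simp: pairwise_def intro: finite_imp_compact)
  also have "\<dots> = (\<Sum>x\<in>A. measure lebesgue (convex hull (insert b (A - {a}))))"
    using measure_child_eq[OF _ assms] by (intro sum.cong refl) fastforce
  finally show ?thesis
    using card_A by simp
qed

end

text \<open>Leibniz's identity: with positions measured from the barycenter, the cross terms add up
  to the squared norm of a vanishing sum.\<close>

lemma sum_sum_dist_squared:
  fixes q :: "'i \<Rightarrow> 'a::real_inner"
  assumes "finite V" "b = (\<Sum>i\<in>V. q i) /\<^sub>R real (card V)"
  shows "(\<Sum>i\<in>V. \<Sum>j\<in>V. (dist (q i) (q j))\<^sup>2) = 2 * real (card V) * (\<Sum>i\<in>V. (dist (q i) b)\<^sup>2)"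
proof (cases "V = {}")
  case False
  define p where "p i = q i - b" for i
  have "(\<Sum>i\<in>V. p i) = 0"
    using assms False by (simp add: p_def sum_subtractf sum_constant_scaleR)
  have z: "(\<Sum>i\<in>V. \<Sum>j\<in>V. p i \<bullet> p j) = 0"
  proof -
    have "(\<Sum>i\<in>V. \<Sum>j\<in>V. p i \<bullet> p j) = (\<Sum>i\<in>V. p i) \<bullet> (\<Sum>j\<in>V. p j)"
      unfolding inner_sum_left inner_sum_right by (rule sum.swap)
    then show ?thesis using \<open>(\<Sum>i\<in>V. p i) = 0\<close> by simp
  qed
  have "(dist (q i) (q j))\<^sup>2 = (dist (q i) b)\<^sup>2 + (dist (q j) b)\<^sup>2 - 2 * (p i \<bullet> p j)" for i j
  proof -
    have "(dist (q i) (q j))\<^sup>2 = (norm (p i - p j))\<^sup>2" by (simp add: p_def dist_norm)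
    then show ?thesis
      by (simp add: dist_norm p_def[symmetric] power2_norm_eq_inner inner_diff_left inner_diff_right inner_commute)
  qed
  then have "(\<Sum>i\<in>V. \<Sum>j\<in>V. (dist (q i) (q j))\<^sup>2) =
      (\<Sum>i\<in>V. \<Sum>j\<in>V. (dist (q i) b)\<^sup>2) + (\<Sum>i\<in>V. \<Sum>j\<in>V. (dist (q j) b)\<^sup>2)
      - 2 * (\<Sum>i\<in>V. \<Sum>j\<in>V. p i \<bullet> p j)"
    by (simp only: sum.distrib sum_subtractf sum_distrib_left)
  also have "\<dots> = 2 * real (card V) * (\<Sum>i\<in>V. (dist (q i) b)\<^sup>2)"
    unfolding z by (simp flip: sum_distrib_left)
  finally show ?thesis .
qed simp

section \<open>Triangulations of nested barycentric systems\<close>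

abbreviation cell :: "(nat \<Rightarrow> 'a::euclidean_space) \<Rightarrow> nat set \<Rightarrow> 'a set" where
  "cell q V \<equiv> convex hull (q ` V)"

abbreviation child :: "nat \<Rightarrow> nat set \<Rightarrow> nat \<Rightarrow> nat set" where
  "child k V m \<equiv> insert k (V - {m})"

text \<open>Affine independence of the image does not detect two indices that share a point;
  injectivity excludes this.\<close>

definition nondegenerate :: "(nat \<Rightarrow> 'a::euclidean_space) \<Rightarrow> nat set \<Rightarrow> bool" where
  "nondegenerate q V \<longleftrightarrow> card V = Suc DIM('a) \<and> inj_on q V \<and> \<not> affine_dependent (q ` V)"

text \<open>The sum runs over ordered pairs, so every edge counts twice.\<close>

definition spread :: "(nat \<Rightarrow> 'a::euclidean_space) \<Rightarrow> nat set \<Rightarrow> real" where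
  "spread q V = (\<Sum>i\<in>V. \<Sum>j\<in>V. (dist (q i) (q j))\<^sup>2)"

text \<open>Weighting by volume prepares a Markov-type bound: a small potential leaves little volume
  for cells of large spread.\<close>

definition potential :: "(nat \<Rightarrow> 'a::euclidean_space) \<Rightarrow> nat set set \<Rightarrow> real" where
  "potential q T = (\<Sum>V\<in>T. measure lebesgue (cell q V) * spread q V)"

text \<open>The fraction of its contribution to the potential that a cell with \<open>n\<close>
  vertices loses when it is split.\<close>

definition gain :: "nat \<Rightarrow> real" where
  "gain n = 1 / real n + 1 / (real n)\<^sup>2"

lemma spread_nonneg: "0 \<le> spread q V"
  by (simp add: spread_def sum_nonneg)

lemma spread_remove:
  assumes "finite V" "m \<in> V"
  shows "spread q V = spread q (V - {m}) + 2 * (\<Sum>j\<in>V. (dist (q m) (q j))\<^sup>2)"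
proof -
  have "spread q V = (\<Sum>j\<in>V. (dist (q m) (q j))\<^sup>2) + (\<Sum>i\<in>V - {m}. \<Sum>j\<in>V. (dist (q i) (q j))\<^sup>2)"
    unfolding spread_def by (rule sum.remove[OF assms])
  also have "(\<Sum>i\<in>V - {m}. \<Sum>j\<in>V. (dist (q i) (q j))\<^sup>2) =
      (\<Sum>i\<in>V - {m}. (dist (q i) (q m))\<^sup>2 + (\<Sum>j\<in>V - {m}. (dist (q i) (q j))\<^sup>2))"
    by (intro sum.cong refl sum.remove[OF assms])
  also have "\<dots> = (\<Sum>i\<in>V - {m}. (dist (q i) (q m))\<^sup>2) + spread q (V - {m})"
    by (simp add: sum.distrib spread_def)
  also have "(\<Sum>i\<in>V - {m}. (dist (q i) (q m))\<^sup>2) = (\<Sum>j\<in>V. (dist (q m) (q j))\<^sup>2)"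
    unfolding sum.remove[OF assms, of "\<lambda>j. (dist (q m) (q j))\<^sup>2"]
    by (simp add: dist_commute)
  finally show ?thesis by simp
qed

text \<open>Let s be the sum of the squared distances from the vertices to the barycenter. Replacing
  \<open>m\<close> by the barycenter removes twice the squared distances from \<open>m\<close> and
  adds twice s minus the term of \<open>m\<close>. Summation over \<open>m\<close> gives (n - 2)
  times the old spread plus 2(n - 1)s, and the old spread is 2ns.\<close>

lemma sum_spread_children:
  assumes "finite V" "V \<noteq> {}" "k \<notin> V" and qk: "q k = barycenter_idx q V"
  shows "(\<Sum>m\<in>V. spread q (child k V m)) = (real (card V) - 1 - 1 / real (card V)) * spread q V"
proof -
  define n where "n = real (card V)"
  have n: "n > 0" using assms by (simp add: n_def card_gt_0_iff)
  define s where "s = (\<Sum>i\<in>V. (dist (q i) (q k))\<^sup>2)"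
  have sp: "spread q V = 2 * n * s"
    unfolding spread_def n_def s_def
    by (rule sum_sum_dist_squared) (use assms in \<open>simp_all add: barycenter_idx_def\<close>)
  have eq: "spread q (child k V m) = spread q V - 2 * (\<Sum>j\<in>V. (dist (q m) (q j))\<^sup>2)
      + 2 * (s - (dist (q m) (q k))\<^sup>2)" if "m \<in> V" for m
  proof -
    have k: "child k V m - {k} = V - {m}" using assms(3) by auto
    have "spread q (child k V m) = spread q (V - {m}) + 2 * (\<Sum>j\<in>child k V m. (dist (q k) (q j))\<^sup>2)"
      using spread_remove[of "child k V m" k q] assms(1) by (simp only: k) simp
    also have "(\<Sum>j\<in>child k V m. (dist (q k) (q j))\<^sup>2) = (\<Sum>j\<in>V - {m}. (dist (q j) (q k))\<^sup>2)"
      using assms(1,3) by (simp add: dist_commute)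
    also have "\<dots> = s - (dist (q m) (q k))\<^sup>2"
      using that assms(1) by (simp add: s_def sum.remove[of V m])
    finally show ?thesis using spread_remove[OF assms(1) that, of q] by simp
  qed
  have "(\<Sum>m\<in>V. spread q (child k V m)) = (\<Sum>m\<in>V. spread q V - 2 * (\<Sum>j\<in>V. (dist (q m) (q j))\<^sup>2)
      + 2 * (s - (dist (q m) (q k))\<^sup>2))"
    by (intro sum.cong refl eq)
  also have "\<dots> = n * spread q V - 2 * spread q V + 2 * (n * s - s)"
    by (simp add: sum.distrib sum_subtractf n_def s_def spread_def flip: sum_distrib_left)
  also have "\<dots> = (n - 1 - 1 / n) * spread q V"
    using n by (simp add: sp field_simps)
  finally show ?thesis by (simp add: n_def)
qed

lemma nondegenerate_finite: "nondegenerate q V \<Longrightarrow> finite V"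
  by (simp add: nondegenerate_def card_ge_0_finite)

lemma nondegenerate_interpretation:
  fixes q :: "nat \<Rightarrow> 'a::euclidean_space"
  assumes "nondegenerate q V"
  shows "nondegenerate_simplex (q ` V) (barycenter_idx q V)"
  using assms
  by (auto simp: nondegenerate_simplex_def nondegenerate_def barycenter_idx_def card_image sum.reindex)

text \<open>This and the next two congruences allow a point sequence to be changed at a fresh index
  without affecting the existing cells.\<close>

lemma nondegenerate_cong:
  assumes "\<And>i. i \<in> V \<Longrightarrow> q i = q' i"
  shows "nondegenerate q V = nondegenerate q' V"
  using assms by (simp add: nondegenerate_def cong: inj_on_cong image_cong)

lemma barycenter_idx_cong:
  assumes "\<And>i. i \<in> V \<Longrightarrow> q i = q' i"
  shows "barycenter_idx q V = barycenter_idx q' V"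
  using assms by (simp add: barycenter_idx_def cong: sum.cong)

lemma spread_cong:
  assumes "\<And>i. i \<in> V \<Longrightarrow> q i = q' i"
  shows "spread q V = spread q' V"
  using assms by (simp add: spread_def cong: sum.cong)

locale splitting =
  fixes q :: "nat \<Rightarrow> 'a::euclidean_space" and V :: "nat set" and k :: nat
  assumes nondeg: "nondegenerate q V" and k: "k \<notin> V" and qk: "q k = barycenter_idx q V"
begin

sublocale nondegenerate_simplex "q ` V" "q k"
  unfolding qk by (rule nondegenerate_interpretation[OF nondeg])

lemma finite_V: "finite V"
  by (rule nondegenerate_finite[OF nondeg])

lemma image_remove:
  assumes "m \<in> V" shows "q ` (V - {m}) = q ` V - {q m}"
  using assms nondeg by (auto simp: nondegenerate_def inj_on_def)

lemma nondegenerate_child: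
  assumes "m \<in> V" shows "nondegenerate q (child k V m)"
proof -
  have "card (child k V m) = Suc DIM('a)"
    using assms nondeg k finite_V by (simp add: nondegenerate_def card_insert_if)
  moreover have "inj_on q (child k V m)"
    unfolding inj_on_insert
    using nondeg barycenter_notin inj_on_subset[OF _ Diff_subset] by (auto simp: nondegenerate_def)
  ultimately show ?thesis
    using child_independent[of "q m"] assms by (simp add: nondegenerate_def image_remove)
qed

lemma cell_child_subset:
  assumes "m \<in> V" shows "cell q (child k V m) \<subseteq> cell q V"
  using child_subset[of "q m"] assms by (simp add: image_remove)

lemma cell_children_Union: "(\<Union>m\<in>V. cell q (child k V m)) = cell q V"
  using children_Union by (simp add: image_remove)

lemma cell_children_overlap:
  assumes "m \<in> V" "m' \<in> V" "m \<noteq> m'"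
  shows "negligible (cell q (child k V m) \<inter> cell q (child k V m'))"
proof -
  have "q m \<noteq> q m'" using assms nondeg by (auto simp: nondegenerate_def inj_on_def)
  then show ?thesis
    using children_overlap[of "q m" "q m'"] assms by (simp add: image_remove)
qed

lemma measure_cell_child:
  assumes "m \<in> V"
  shows "measure lebesgue (cell q (child k V m)) = measure lebesgue (cell q V) / Suc DIM('a)"
  using measure_child[of "q m"] assms card_A by (simp add: image_remove)

lemma inj_child: "inj_on (child k V) V"
  using k by (auto simp: inj_on_def)

text \<open>Every child has 1/n of the volume, and the spreads of the children sum to n - 1 - 1/n
  times the old one; the product of the two factors is 1 - 1/n - 1/n^2.\<close>

lemma potential_children:
  "(\<Sum>m\<in>V. measure lebesgue (cell q (child k V m)) * spread q (child k V m)) =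
    (1 - gain (Suc DIM('a))) * (measure lebesgue (cell q V) * spread q V)"
proof -
  define n where "n = real (card V)"
  have cV: "card V = Suc DIM('a)" and n: "n > 0" "real (Suc DIM('a)) = n"
    using nondeg by (simp_all add: nondegenerate_def n_def)
  have "(\<Sum>m\<in>V. measure lebesgue (cell q (child k V m)) * spread q (child k V m)) =
      measure lebesgue (cell q V) / n * (\<Sum>m\<in>V. spread q (child k V m))"
    unfolding sum_distrib_left unfolding n(2)[symmetric] by (intro sum.cong refl) (simp only: measure_cell_child times_divide_eq_left)
  also have "(\<Sum>m\<in>V. spread q (child k V m)) = (n - 1 - 1 / n) * spread q V"
    unfolding n_def by (rule sum_spread_children) (use finite_V cV k qk in auto)
  finally show ?thesis
    unfolding gain_def n(2) using n(1) by (simp add: field_simps power2_eq_square)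
qed

end

section \<open>Invariants of nested barycentric systems\<close>

lemma bary_nbs_vertices:
  assumes "bary_nbs q t T" "V \<in> T"
  shows "V \<subseteq> {..t}"
  using assms
proof (induction arbitrary: V)
  case (step j T V')
  then show ?case by (fastforce simp: split_simplex_def)
qed auto

lemma bary_nbs_dim_le:
  fixes q :: "nat \<Rightarrow> 'a::euclidean_space"
  shows "bary_nbs q t T \<Longrightarrow> DIM('a) \<le> t"
  by (induction rule: bary_nbs.induct) auto

lemma bary_nbs_cong:
  assumes "bary_nbs q t T" "\<And>i. i \<le> t \<Longrightarrow> q i = q' i"
  shows "bary_nbs q' t T"
  using assms
proof (induction)
  case base
  show ?case by (rule bary_nbs.base)
next
  case (step j T V)
  have V: "q i = q' i" if "i \<in> V" for i
    using bary_nbs_vertices[OF step.hyps(1,2)] that step.prems by force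
  then have "q ` V = q' ` V" by (rule image_cong[OF refl])
  moreover have "barycenter_idx q V = barycenter_idx q' V"
    using V by (rule barycenter_idx_cong)
  moreover have "q (Suc j) = q' (Suc j)" using step.prems by blast
  ultimately show ?case
    using step by (intro bary_nbs.step) auto
qed

text \<open>A split replaces a cell by children that cover the same set and overlap each other in
  null sets; their overlaps with the remaining cells lie inside those of the parent.\<close>

lemma bary_nbs_invariants:
  fixes q :: "nat \<Rightarrow> 'a::euclidean_space"
  assumes "bary_nbs q t T" and base: "nondegenerate q {0..DIM('a)}"
  shows "finite T \<and> (\<forall>V\<in>T. nondegenerate q V) \<and> (\<Union>V\<in>T. cell q V) = cell q {0..DIM('a)} \<and>
    pairwise (\<lambda>V W. negligible (cell q V \<inter> cell q W)) T"
  using assms(1)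
proof (induction)
  case base
  then show ?case using assms(2) by simp
next
  case (step j T V)
  interpret splitting q V "Suc j"
    using step bary_nbs_vertices[OF step.hyps(1,2)] by unfold_locales auto
  have split: "split_simplex T V (Suc j) = (T - {V}) \<union> child (Suc j) V ` V"
    by (auto simp: split_simplex_def)
  have T: "T = insert V (T - {V})" using step.hyps by auto
  have "(\<Union>W\<in>split_simplex T V (Suc j). cell q W) = (\<Union>W\<in>T - {V}. cell q W) \<union> cell q V"
    unfolding split UN_Un UN_simps(10) image_image using cell_children_Union by simp
  also have "\<dots> = (\<Union>W\<in>T. cell q W)"
    by (subst (2) T) blast
  finally have un: "(\<Union>W\<in>split_simplex T V (Suc j). cell q W) = cell q {0..DIM('a)}"
    using step.IH by simp
  have old: "negligible (cell q W \<inter> cell q (child (Suc j) V m))"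
    "negligible (cell q (child (Suc j) V m) \<inter> cell q W)" if "W \<in> T - {V}" "m \<in> V" for W m
  proof -
    have "negligible (cell q W \<inter> cell q V)"
      using step.IH step.hyps(2) that by (auto simp: pairwise_def)
    then show "negligible (cell q W \<inter> cell q (child (Suc j) V m))"
      using cell_child_subset[OF that(2)] by (auto intro: negligible_subset)
    then show "negligible (cell q (child (Suc j) V m) \<inter> cell q W)"
      by (simp add: Int_commute)
  qed
  have "pairwise (\<lambda>V W. negligible (cell q V \<inter> cell q W)) (split_simplex T V (Suc j))"
    unfolding split pairwise_def
  proof (intro ballI impI)
    fix W W' assume *: "W \<in> (T - {V}) \<union> child (Suc j) V ` V" "W' \<in> (T - {V}) \<union> child (Suc j) V ` V" "W \<noteq> W'"
    then consider "W \<in> T - {V}" "W' \<in> T - {V}"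
      | m where "W \<in> T - {V}" "m \<in> V" "W' = child (Suc j) V m"
      | m where "W' \<in> T - {V}" "m \<in> V" "W = child (Suc j) V m"
      | m m' where "m \<in> V" "m' \<in> V" "W = child (Suc j) V m" "W' = child (Suc j) V m'"
      by blast
    then show "negligible (cell q W \<inter> cell q W')"
    proof cases
      case 1
      from step.IH have "pairwise (\<lambda>V W. negligible (cell q V \<inter> cell q W)) T" by blast
      from pairwiseD[OF this _ _ *(3)] 1 show ?thesis by blast
    next
      case 2
      then show ?thesis unfolding 2(3) by (intro old)
    next
      case 3
      then show ?thesis unfolding 3(3) by (intro old)
    next
      case 4
      then have "m \<noteq> m'" using *(3) by blast
      then show ?thesis unfolding 4(3,4) by (rule cell_children_overlap[OF 4(1,2)])
    qed
  qed
  moreover have "finite (split_simplex T V (Suc j))"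
    using step.IH finite_V by (simp add: split)
  moreover have "\<forall>W\<in>split_simplex T V (Suc j). nondegenerate q W"
    using step.IH nondegenerate_child by (auto simp: split)
  ultimately show ?case using un by blast
qed

section \<open>Decrease of the potential under repeated splitting\<close>

lemma gain_bounds: "0 < gain (Suc (Suc n))" "gain (Suc (Suc n)) < 1"
proof -
  define r where "r = real (Suc (Suc n))"
  have r: "r \<ge> 2" by (simp add: r_def)
  show "0 < gain (Suc (Suc n))"
    using r unfolding gain_def r_def[symmetric] by (simp add: add_pos_pos)
  \<comment> \<open>The gain is (r + 1)/r^2, which is below 1 for r \<ge> 2. Here r is the number d
    + 1 of vertices, so d \<ge> 1 is what matters.\<close>
  have "r + 1 < r * r"
    using mult_right_mono[OF r, of r] r by linarith
  then show "gain (Suc (Suc n)) < 1"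
    using r unfolding gain_def r_def[symmetric] by (simp add: divide_simps power2_eq_square)
qed

lemma potential_cong:
  assumes "\<And>V i. V \<in> T \<Longrightarrow> i \<in> V \<Longrightarrow> q i = q' i"
  shows "potential q T = potential q' T"
  unfolding potential_def
proof (intro sum.cong refl)
  fix V assume "V \<in> T"
  then have "\<And>i. i \<in> V \<Longrightarrow> q i = q' i" using assms by blast
  then show "measure lebesgue (cell q V) * spread q V = measure lebesgue (cell q' V) * spread q' V"
    using spread_cong[of V q q'] by (simp cong: image_cong)
qed

text \<open>Every cell may be split, since its barycenter lies in its interior. Only the
  contribution of \<open>V\<close> to the potential changes.\<close>

lemma bary_nbs_split:
  fixes q :: "nat \<Rightarrow> 'a::euclidean_space"
  assumes nbs: "bary_nbs q t T" and base: "nondegenerate q {0..DIM('a)}" and V: "V \<in> T"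
  defines "q' \<equiv> q(Suc t := barycenter_idx q V)"
  shows "bary_nbs q' (Suc t) (split_simplex T V (Suc t))"
    and "splitting q' V (Suc t)"
    and "potential q' (split_simplex T V (Suc t)) =
      potential q T - gain (Suc DIM('a)) * (measure lebesgue (cell q V) * spread q V)"
proof -
  have inv: "finite T" "nondegenerate q V"
    using bary_nbs_invariants[OF nbs base] V by auto
  have VT: "W \<subseteq> {..t}" if "W \<in> T" for W
    using bary_nbs_vertices[OF nbs that] .
  have agree: "q i = q' i" if "i \<le> t" for i
    using that by (simp add: q'_def)
  have agreeV: "q i = q' i" if "W \<in> T" "i \<in> W" for W i
    using VT[OF that(1)] that(2) agree by blast
  have k: "Suc t \<notin> V" using VT[OF V] by auto
  have b: "q' (Suc t) = barycenter_idx q' V"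
  proof -
    have "barycenter_idx q V = barycenter_idx q' V"
      by (rule barycenter_idx_cong) (rule agreeV[OF V])
    then show ?thesis by (simp add: q'_def)
  qed
  have nd: "nondegenerate q' V"
    using inv(2) agreeV[OF V] by (subst nondegenerate_cong[of _ _ q]) auto
  show *: "splitting q' V (Suc t)"
    using nd k b by unfold_locales
  then interpret splitting q' V "Suc t" .
  show "bary_nbs q' (Suc t) (split_simplex T V (Suc t))"
    using bary_nbs_cong[OF nbs agree] V barycenter_in_interior b by (rule bary_nbs.step)
  have split: "split_simplex T V (Suc t) = (T - {V}) \<union> child (Suc t) V ` V"
    by (auto simp: split_simplex_def)
  \<comment> \<open>Children contain the index \<open>Suc t\<close>, which occurs in no older
    cell.\<close>
  have disj: "(T - {V}) \<inter> child (Suc t) V ` V = {}"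
    using VT by fastforce
  have "potential q' (split_simplex T V (Suc t)) = potential q' (T - {V}) + potential q' (child (Suc t) V ` V)"
    unfolding split potential_def using inv(1) finite_V disj by (intro sum.union_disjoint) auto
  also have "potential q' (child (Suc t) V ` V) =
      (1 - gain (Suc DIM('a))) * (measure lebesgue (cell q' V) * spread q' V)"
    unfolding potential_def sum.reindex[OF inj_child] comp_def by (rule potential_children)
  also have "potential q' (T - {V}) + \<dots> =
      potential q' T - gain (Suc DIM('a)) * (measure lebesgue (cell q' V) * spread q' V)"
    unfolding potential_def sum.remove[OF inv(1) V] by (simp add: algebra_simps)
  also have "potential q' T = potential q T"
    using agreeV by (intro potential_cong) simp
  also have "measure lebesgue (cell q' V) * spread q' V = measure lebesgue (cell q V) * spread q V"
  proof -
    have "spread q V = spread q' V" by (rule spread_cong) (rule agreeV[OF V])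
    moreover have "q ` V = q' ` V" by (rule image_cong[OF refl]) (rule agreeV[OF V])
    ultimately show ?thesis by simp
  qed
  finally show "potential q' (split_simplex T V (Suc t)) =
      potential q T - gain (Suc DIM('a)) * (measure lebesgue (cell q V) * spread q V)" .
qed

text \<open>For a new index i, the index set par i is the cell into which the point i was placed.\<close>

lemma bary_nbs_refine:
  fixes q :: "nat \<Rightarrow> 'a::euclidean_space"
  assumes nbs: "bary_nbs q t T" and base: "nondegenerate q {0..DIM('a)}" and "U \<subseteq> T"
  shows "\<exists>q' t' T' par. t \<le> t' \<and> (\<forall>i\<le>t. q' i = q i) \<and> bary_nbs q' t' T' \<and> T - U \<subseteq> T' \<and>
    potential q' T' = potential q T
      - gain (Suc DIM('a)) * (\<Sum>V\<in>U. measure lebesgue (cell q V) * spread q V) \<and>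
    (\<forall>W\<in>T'. \<forall>i\<in>W. t < i \<longrightarrow> par i \<in> U \<and> cell q' W \<subseteq> cell q (par i)) \<and>
    (\<forall>W\<in>T'. W \<in> T - U \<or> (\<exists>i\<in>W. t < i))"
proof -
  have "finite T" using bary_nbs_invariants[OF nbs base] by blast
  then have "finite U" using \<open>U \<subseteq> T\<close> by (rule finite_subset[rotated])
  then show ?thesis using \<open>U \<subseteq> T\<close>
  proof (induction)
    case empty
    \<comment> \<open>With nothing to split, the conditions on indices above \<open>t\<close> hold
      vacuously, whatever \<open>par\<close> is.\<close>
    have "\<forall>W\<in>T. \<forall>i\<in>W. i \<le> t"
      using bary_nbs_vertices[OF nbs] by blast
    then show ?case
      using nbs by (intro exI[of _ q] exI[of _ t] exI[of _ T]) (auto simp: not_less[symmetric])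
  next
    case (insert V U)
    have "U \<subseteq> T" "V \<in> T" "V \<notin> U"
      using insert.hyps insert.prems by auto
    from insert.IH[OF this(1)] obtain q1 t1 T1 par where t1: "t \<le> t1" and q1: "\<forall>i\<le>t. q1 i = q i"
      and nbs1: "bary_nbs q1 t1 T1" and sub: "T - U \<subseteq> T1"
      and pot: "potential q1 T1 = potential q T
        - gain (Suc DIM('a)) * (\<Sum>V\<in>U. measure lebesgue (cell q V) * spread q V)"
      and par: "\<forall>W\<in>T1. \<forall>i\<in>W. t < i \<longrightarrow> par i \<in> U \<and> cell q1 W \<subseteq> cell q (par i)"
      and new: "\<forall>W\<in>T1. W \<in> T - U \<or> (\<exists>i\<in>W. t < i)"
      by (elim exE conjE)
    \<comment> \<open>The cells still waiting to be split have survived so far; the clause on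
      \<open>T - U\<close> is carried through the induction for this purpose.\<close>
    have V1: "V \<in> T1" using \<open>V \<in> T\<close> \<open>V \<notin> U\<close> sub by blast
    have VT: "V \<subseteq> {..t}" by (rule bary_nbs_vertices[OF nbs \<open>V \<in> T\<close>])
    have base1: "nondegenerate q1 {0..DIM('a)}"
      using base nondegenerate_cong[of "{0..DIM('a)}" q1 q] q1 bary_nbs_dim_le[OF nbs] by simp
    define k where "k = Suc t1"
    define q2 where "q2 = q1(k := barycenter_idx q1 V)"
    note split = bary_nbs_split[OF nbs1 base1 V1, folded k_def, folded q2_def]
    interpret splitting q2 V k by (rule split(2))
    have tk: "t < k" using t1 by (simp add: k_def)
    have q2: "q2 i = q i" if "i \<le> t" for i
      using that q1 t1 by (simp add: q2_def k_def)
    have old: "W \<subseteq> {..t1}" "cell q2 W = cell q1 W" if "W \<in> T1" for W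
    proof -
      show W: "W \<subseteq> {..t1}" by (rule bary_nbs_vertices[OF nbs1 that])
      then have "q2 ` W = q1 ` W" by (intro image_cong refl) (auto simp: q2_def k_def)
      then show "cell q2 W = cell q1 W" by simp
    qed
    have cV: "cell q2 V = cell q V"
      using VT q2 by (intro arg_cong[where f="\<lambda>X. convex hull X"] image_cong refl) blast
    define par2 where "par2 = par(k := V)"
    have T2: "split_simplex T1 V k = (T1 - {V}) \<union> child k V ` V"
      by (auto simp: split_simplex_def)
    have par2: "par2 i \<in> insert V U \<and> cell q2 W \<subseteq> cell q (par2 i)"
      if "W \<in> split_simplex T1 V k" "i \<in> W" "t < i" for W i
    proof -
      from that(1) consider "W \<in> T1" | m where "m \<in> V" "W = child k V m"
        unfolding T2 by blast
      then show ?thesis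
      proof cases
        case 1
        then have "i \<noteq> k" using old(1)[OF 1] that(2) by (auto simp: k_def)
        then show ?thesis using par 1 that(2,3) old(2)[OF 1] by (simp add: par2_def)
      next
        case 2
        \<comment> \<open>\<open>V\<close> belongs to the original triangulation, so its indices are
          at most \<open>t\<close> and \<open>k\<close> is the only new index in the child.\<close>
        then have "i = k" using that(2,3) VT by auto
        then show ?thesis using cell_child_subset[OF 2(1)] unfolding 2(2) cV by (simp add: par2_def)
      qed
    qed
    have new2: "W \<in> T - insert V U \<or> (\<exists>i\<in>W. t < i)" if "W \<in> split_simplex T1 V k" for W
      using that new tk unfolding T2 by blast
    have sp: "spread q1 V = spread q V" "cell q1 V = cell q V"
      using cV old(2)[OF V1] VT q1 by (auto intro!: spread_cong)
    have pot2: "potential q2 (split_simplex T1 V k) = potential q T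
        - gain (Suc DIM('a)) * (\<Sum>V\<in>insert V U. measure lebesgue (cell q V) * spread q V)"
      unfolding split(3) pot sp sum.insert[OF insert(1,2)] by (simp add: algebra_simps)
    have "T - insert V U \<subseteq> split_simplex T1 V k"
      unfolding T2 using sub by blast
    moreover have "t \<le> k" using tk by simp
    moreover have "\<forall>i\<le>t. q2 i = q i" using q2 by blast
    moreover have "\<forall>W\<in>split_simplex T1 V k. \<forall>i\<in>W. t < i \<longrightarrow>
        par2 i \<in> insert V U \<and> cell q2 W \<subseteq> cell q (par2 i)"
      by (intro ballI impI par2)
    moreover have "\<forall>W\<in>split_simplex T1 V k. W \<in> T - insert V U \<or> (\<exists>i\<in>W. t < i)"
      by (intro ballI new2)
    ultimately show ?case
      using split(1) pot2 by (intro exI conjI)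
  qed
qed

text \<open>One round splits all cells of the current triangulation, which multiplies the potential
  by one minus the gain.\<close>

lemma bary_nbs_potential_power:
  fixes q :: "nat \<Rightarrow> 'a::euclidean_space"
  assumes base: "nondegenerate q {0..DIM('a)}"
  shows "\<exists>q' t T. (\<forall>i\<le>DIM('a). q' i = q i) \<and> bary_nbs q' t T \<and>
    potential q' T = (1 - gain (Suc DIM('a))) ^ n * potential q {{0..DIM('a)}}"
proof (induction n)
  case 0
  show ?case using bary_nbs.base by fastforce
next
  case (Suc n)
  then obtain q1 t1 T1 where q1: "\<And>i. i \<le> DIM('a) \<Longrightarrow> q1 i = q i" and nbs: "bary_nbs q1 t1 T1"
    and pot: "potential q1 T1 = (1 - gain (Suc DIM('a))) ^ n * potential q {{0..DIM('a)}}"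
    by blast
  have base1: "nondegenerate q1 {0..DIM('a)}"
    using base nondegenerate_cong[of "{0..DIM('a)}" q1 q] q1 by simp
  obtain q2 t2 T2 where "\<forall>i\<le>t1. q2 i = q1 i" "bary_nbs q2 t2 T2"
    "potential q2 T2 = potential q1 T1 - gain (Suc DIM('a)) * (\<Sum>V\<in>T1. measure lebesgue (cell q1 V) * spread q1 V)"
    using bary_nbs_refine[OF nbs base1 subset_refl] by (elim exE conjE)
  moreover from this(3) have "potential q2 T2 = (1 - gain (Suc DIM('a))) * potential q1 T1"
    unfolding potential_def[of q1 T1, symmetric] by (simp add: algebra_simps)
  moreover have "\<forall>i\<le>DIM('a). q2 i = q i"
    using calculation(1) q1 bary_nbs_dim_le[OF nbs] by auto
  moreover have "(1 - gain (Suc DIM('a))) * potential q1 T1 = (1 - gain (Suc DIM('a))) ^ Suc n * potential q {{0..DIM('a)}}"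
    unfolding pot by simp
  ultimately show ?case by metis
qed

lemma bary_nbs_small_potential:
  fixes q :: "nat \<Rightarrow> 'a::euclidean_space"
  assumes base: "nondegenerate q {0..DIM('a)}" and "e > 0"
  shows "\<exists>q' t T. (\<forall>i\<le>DIM('a). q' i = q i) \<and> bary_nbs q' t T \<and> potential q' T < e"
proof -
  obtain d where d: "DIM('a) = Suc d"
    using DIM_positive[where 'a='a] gr0_implies_Suc by blast
  have "(\<lambda>n. (1 - gain (Suc DIM('a))) ^ n * potential q {{0..DIM('a)}}) \<longlonglongrightarrow> 0"
    using gain_bounds[of d] by (intro tendsto_mult_left_zero LIMSEQ_power_zero) (simp add: d)
  then have "\<forall>\<^sub>F n in sequentially. (1 - gain (Suc DIM('a))) ^ n * potential q {{0..DIM('a)}} < e"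
    using \<open>e > 0\<close> by (rule order_tendstoD)
  then obtain n where "(1 - gain (Suc DIM('a))) ^ n * potential q {{0..DIM('a)}} < e"
    by (auto simp: eventually_sequentially)
  then show ?thesis
    using bary_nbs_potential_power[OF base, of n] by metis
qed

section \<open>Barycentric coordinates in nondegenerate cells\<close>

lemma nondegenerate_coords_unique:
  assumes nd: "nondegenerate q V"
    and "sum \<alpha> V = 1" "(\<Sum>i\<in>V. \<alpha> i *\<^sub>R q i) = x" "sum \<beta> V = 1" "(\<Sum>i\<in>V. \<beta> i *\<^sub>R q i) = x"
    and "i \<in> V"
  shows "\<alpha> i = \<beta> i"
proof (rule ccontr)
  assume "\<alpha> i \<noteq> \<beta> i"
  \<comment> \<open>The difference of the two coordinate vectors, moved from indices to points,
    would be a nontrivial affine dependence of the vertices.\<close>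
  define u where "u v = \<alpha> (inv_into V q v) - \<beta> (inv_into V q v)" for v
  have inj: "inj_on q V" using nd by (simp add: nondegenerate_def)
  have u: "u (q j) = \<alpha> j - \<beta> j" if "j \<in> V" for j
    using that inj by (simp add: u_def)
  have "sum u (q ` V) = 0"
    unfolding sum.reindex[OF inj] using assms u by (simp add: sum_subtractf)
  moreover have "(\<Sum>v\<in>q ` V. u v *\<^sub>R v) = 0"
    unfolding sum.reindex[OF inj] using assms u by (simp add: scaleR_diff_left sum_subtractf)
  moreover have "u (q i) \<noteq> 0" using u \<open>i \<in> V\<close> \<open>\<alpha> i \<noteq> \<beta> i\<close> by simp
  ultimately have "affine_dependent (q ` V)"
    unfolding affine_dependent_explicit_finite[OF finite_imageI[OF nondegenerate_finite[OF nd]]]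
    using \<open>i \<in> V\<close> by blast
  then show False using nd by (simp add: nondegenerate_def)
qed

text \<open>Existence from the convex hull and uniqueness from independence make the definite
  description in \<open>bary_coords\<close> meaningful.\<close>

lemma bary_coords:
  assumes nd: "nondegenerate q V" and x: "x \<in> cell q V"
  shows "\<And>i. i \<notin> V \<Longrightarrow> bary_coords q V x i = 0" "\<And>i. i \<in> V \<Longrightarrow> 0 \<le> bary_coords q V x i"
    "sum (bary_coords q V x) V = 1" "(\<Sum>i\<in>V. bary_coords q V x i *\<^sub>R q i) = x"
proof -
  let ?P = "\<lambda>\<alpha>. (\<forall>i. i \<notin> V \<longrightarrow> \<alpha> i = 0) \<and> (\<forall>i\<in>V. 0 \<le> \<alpha> i) \<and> sum \<alpha> V = 1 \<and> (\<Sum>i\<in>V. \<alpha> i *\<^sub>R q i) = x"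
  have inj: "inj_on q V" using nd by (simp add: nondegenerate_def)
  obtain u where u: "\<And>v. v \<in> q ` V \<Longrightarrow> 0 \<le> u v" "sum u (q ` V) = 1" "(\<Sum>v\<in>q ` V. u v *\<^sub>R v) = x"
    using x by (auto simp: convex_hull_finite nondegenerate_finite[OF nd])
  define \<alpha> where "\<alpha> i = (if i \<in> V then u (q i) else 0)" for i
  have a: "?P \<alpha>"
    using u unfolding sum.reindex[OF inj] by (simp add: \<alpha>_def)
  have "\<beta> = \<alpha>" if "?P \<beta>" for \<beta>
  proof
    fix i show "\<beta> i = \<alpha> i"
      using nondegenerate_coords_unique[OF nd, of \<beta> x \<alpha> i] a that by (cases "i \<in> V") auto
  qed
  with a have "?P (bary_coords q V x)"
    unfolding bary_coords_def by (rule theI)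
  then show "\<And>i. i \<notin> V \<Longrightarrow> bary_coords q V x i = 0" "\<And>i. i \<in> V \<Longrightarrow> 0 \<le> bary_coords q V x i"
    "sum (bary_coords q V x) V = 1" "(\<Sum>i\<in>V. bary_coords q V x i *\<^sub>R q i) = x"
    by blast+
qed

lemma bary_coords_zero:
  assumes nd: "nondegenerate q V" and x: "x \<in> cell q V" and i: "i \<in> V" "bary_coords q V x i = 0"
  shows "x \<in> cell q (V - {i})"
proof -
  note c = bary_coords[OF nd x] and fin = nondegenerate_finite[OF nd]
  have "(\<Sum>j\<in>V - {i}. bary_coords q V x j *\<^sub>R q j) \<in> cell q (V - {i})"
    using c(2,3) fin i by (intro convex_sum) (auto simp: sum.remove[of V i] intro: hull_inc)
  then show ?thesis
    using c(4) fin i by (simp add: sum.remove[of V i])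
qed

lemma negligible_cell_facet:
  fixes q :: "nat \<Rightarrow> 'a::euclidean_space"
  assumes nd: "nondegenerate q V" and "i \<in> V"
  shows "negligible (cell q (V - {i}))"
proof (rule negligible_convex_hull_card)
  show fin: "finite (q ` (V - {i}))" using nondegenerate_finite[OF nd] by simp
  have "card (q ` (V - {i})) \<le> card (V - {i})"
    using nondegenerate_finite[OF nd] by (simp add: card_image_le)
  also have "\<dots> = DIM('a)"
    using nd nondegenerate_finite[OF nd] \<open>i \<in> V\<close> by (simp add: nondegenerate_def)
  finally show "card (q ` (V - {i})) \<le> DIM('a)" .
qed

section \<open>Approximation of a convex body\<close>

text \<open>The closed tubes of radius 1/(n + 1) decrease to \<open>P\<close>, because
  \<open>P\<close> is closed; continuity of the measure from above applies as the tubes are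
  compact.\<close>

lemma measure_infdist_tube:
  fixes P :: "'a::euclidean_space set"
  assumes P: "compact P" "P \<noteq> {}" and "e > 0"
  obtains \<delta> where "\<delta> > 0" "measure lebesgue ({x. infdist x P \<le> \<delta>} - P) < e"
proof -
  define A where "A n = {x. infdist x P \<le> 1 / real (Suc n)}" for n
  have A: "compact (A n)" for n
    unfolding A_def using P by (intro compact_infdist_le) auto
  have lm: "A n \<in> lmeasurable" for n
    by (rule lmeasurable_compact[OF A])
  have sub: "P \<subseteq> A n" for n by (auto simp: A_def)
  have "1 / real (Suc (Suc n)) \<le> 1 / real (Suc n)" for n
    by (simp add: frac_le)
  then have "decseq A"
    unfolding A_def by (intro decseq_SucI Collect_mono impI) (rule order_trans)
  moreover have "(\<Inter>n. A n) = P"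
  proof
    show "(\<Inter>n. A n) \<subseteq> P"
    proof
      fix x assume "x \<in> (\<Inter>n. A n)"
      then have le: "infdist x P \<le> 1 / real (Suc n)" for n by (auto simp: A_def)
      have "infdist x P = 0"
      proof (rule ccontr)
        assume "infdist x P \<noteq> 0"
        then have "0 < infdist x P" using infdist_nonneg[of x P] by linarith
        then obtain n where "inverse (real (Suc n)) < infdist x P" using reals_Archimedean by blast
        then show False using le[of n] by (simp add: inverse_eq_divide)
      qed
      then show "x \<in> P" using in_closed_iff_infdist_zero[OF compact_imp_closed[OF P(1)] P(2)] by simp
    qed
  qed (use sub in blast)
  moreover have "range A \<subseteq> sets lebesgue" "emeasure lebesgue (A n) \<noteq> \<infinity>" for n
    using fmeasurableD[OF lm] fmeasurableD2[OF lm, of n] by (simp_all add: image_subset_iff)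
  ultimately have "(\<lambda>n. measure lebesgue (A n)) \<longlonglongrightarrow> measure lebesgue P"
    using Lim_measure_decseq[of A lebesgue] by simp
  then have "\<forall>\<^sub>F n in sequentially. measure lebesgue (A n) < measure lebesgue P + e"
    using \<open>e > 0\<close> by (intro order_tendstoD(2)) auto
  then obtain n where n: "measure lebesgue (A n) < measure lebesgue P + e"
    by (auto simp: eventually_sequentially)
  have "measure lebesgue (A n - P) = measure lebesgue (A n) - measure lebesgue P"
    using lm sub lmeasurable_compact[OF P(1)] by (intro measurable_measure_Diff) auto
  with n that[of "1 / real (Suc n)"] show thesis by (simp add: A_def)
qed

text \<open>Separate \<open>p\<close> from \<open>P\<close> by a hyperplane and move the center from
  \<open>p\<close> away from it by \<open>e / 2\<close>. The ball of radius \<open>e / 2\<close>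
  then stays on the side of \<open>p\<close>.\<close>

lemma cball_avoiding_convex:
  fixes P :: "'a::euclidean_space set"
  assumes "closed P" "convex P" "p \<notin> P" "e > 0"
  obtains c where "cball c (e / 2) \<subseteq> cball p e - P"
proof -
  obtain a b where ab: "a \<bullet> p < b" "\<And>x. x \<in> P \<Longrightarrow> b < a \<bullet> x"
    using separating_hyperplane_closed_point[OF assms(2,1,3)] by blast
  \<comment> \<open>This is the unit normal, or 0 if \<open>a\<close> is 0, which can happen only
    for empty \<open>P\<close>; both cases satisfy the two facts about \<open>u\<close>
    below.\<close>
  define u where "u = sgn a"
  define c where "c = p - (e / 2) *\<^sub>R u"
  have u: "norm u \<le> 1" "a \<bullet> u = norm a"
    by (cases "a = 0"; simp add: u_def norm_sgn sgn_div_norm flip: power2_norm_eq_inner;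
        simp add: power2_eq_square)+
  have "y \<in> cball p e - P" if "y \<in> cball c (e / 2)" for y
  proof -
    have d: "norm (y - c) \<le> e / 2" using that by (simp add: dist_norm norm_minus_commute)
    have yp: "y - p = (y - c) - (e / 2) *\<^sub>R u" by (simp add: c_def)
    have "norm (y - p) \<le> norm (y - c) + norm ((e / 2) *\<^sub>R u)"
      unfolding yp by (rule norm_triangle_ineq4)
    also have "\<dots> \<le> e / 2 + e / 2"
      using d u(1) \<open>e > 0\<close> by (intro add_mono) (auto simp: mult_left_le)
    finally have "y \<in> cball p e" by (simp add: dist_norm norm_minus_commute)
    moreover have "a \<bullet> (y - p) \<le> 0"
    proof -
      have "a \<bullet> (y - c) \<le> norm a * norm (y - c)" by (rule norm_cauchy_schwarz)
      also have "\<dots> \<le> norm a * (e / 2)" using d by (intro mult_left_mono) auto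
      finally show ?thesis unfolding yp by (simp add: inner_diff_right u(2) mult.commute)
    qed
    then have "a \<bullet> y < b" using ab(1) by (simp add: inner_diff_right)
    then have "y \<notin> P" using ab(2)[of y] by auto
    ultimately show ?thesis by blast
  qed
  then show thesis using that by blast
qed

lemma inner_parallel_subset_if_small_measure:
  fixes P X :: "'a::euclidean_space set"
  assumes P: "closed P" "convex P" and "e > 0" and X: "X - P \<in> lmeasurable"
    and small: "measure lebesgue (X - P) < measure lebesgue (cball (0::'a) (e / 2))"
  shows "inner_parallel X e \<subseteq> P"
proof
  fix p assume "p \<in> inner_parallel X e"
  then have p: "cball p e \<subseteq> X" by (simp add: inner_parallel_def)
  show "p \<in> P"
  proof (rule ccontr)
    assume "p \<notin> P"
    then obtain c where "cball c (e / 2) \<subseteq> cball p e - P"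
      using cball_avoiding_convex[OF P _ \<open>e > 0\<close>] by blast
    with p have "measure lebesgue (cball c (e / 2)) \<le> measure lebesgue (X - P)"
      by (intro measure_mono_fmeasurable X) auto
    moreover have "measure lebesgue (cball c (e / 2)) = measure lebesgue (cball (0::'a) (e / 2))"
      using \<open>e > 0\<close> by (simp add: measure_completion content_cball)
    ultimately show False using small by simp
  qed
qed

text \<open>The largest distance in a cell is attained at two vertices, and its square is one
  summand of the spread.\<close>

lemma dist_less_if_spread_less:
  assumes "finite V" "x \<in> cell q V" "y \<in> cell q V" "spread q V < \<delta>\<^sup>2" "\<delta> > 0"
  shows "dist x y < \<delta>"
proof -
  have "q ` V \<noteq> {}" using assms(2) by auto
  with assms(1) obtain u v where uv: "u \<in> q ` V" "v \<in> q ` V"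
    "\<forall>x\<in>cell q V. \<forall>y\<in>cell q V. norm (x - y) \<le> norm (u - v)"
    using simplex_extremal_le[of "q ` V"] by blast
  then obtain i j where ij: "i \<in> V" "j \<in> V" "u = q i" "v = q j" by blast
  have "(dist (q i) (q j))\<^sup>2 \<le> (\<Sum>j\<in>V. (dist (q i) (q j))\<^sup>2)"
    using assms(1) ij by (intro member_le_sum) auto
  also have "\<dots> \<le> spread q V"
    unfolding spread_def using assms(1) ij
    by (intro member_le_sum[where f="\<lambda>i. \<Sum>j\<in>V. (dist (q i) (q j))\<^sup>2"]) (auto simp: sum_nonneg)
  finally have "(dist (q i) (q j))\<^sup>2 < \<delta>\<^sup>2" using assms(4) by simp
  then have "dist (q i) (q j) < \<delta>" using \<open>\<delta> > 0\<close> by (simp add: power_less_imp_less_base)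
  then show ?thesis using uv(3) assms(2,3) ij by (force simp: dist_norm)
qed

lemma lmeasurable_cell: "finite V \<Longrightarrow> cell q V \<in> lmeasurable"
  by (intro lmeasurable_compact compact_convex_hull finite_imp_compact) simp

text \<open>Markov's inequality: in the selected cells the spread divided by
  \<open>\<delta>\<^sup>2\<close> is at least 1.\<close>

lemma measure_large_spread:
  assumes T: "finite T" "\<And>V. V \<in> T \<Longrightarrow> finite V" and "\<delta> > 0"
  shows "measure lebesgue (\<Union>V\<in>{V \<in> T. \<delta>\<^sup>2 \<le> spread q V}. cell q V) \<le> potential q T / \<delta>\<^sup>2"
proof -
  have "measure lebesgue (\<Union>V\<in>{V \<in> T. \<delta>\<^sup>2 \<le> spread q V}. cell q V)
      \<le> (\<Sum>V\<in>{V \<in> T. \<delta>\<^sup>2 \<le> spread q V}. measure lebesgue (cell q V))"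
    using T lmeasurable_cell by (intro measure_UNION_le) (auto simp: fmeasurable_def)
  also have "\<dots> \<le> (\<Sum>V\<in>{V \<in> T. \<delta>\<^sup>2 \<le> spread q V}. measure lebesgue (cell q V) * spread q V / \<delta>\<^sup>2)"
    using \<open>\<delta> > 0\<close> by (intro sum_mono) (auto simp: pos_le_divide_eq mult_left_mono)
  also have "\<dots> \<le> (\<Sum>V\<in>T. measure lebesgue (cell q V) * spread q V / \<delta>\<^sup>2)"
    using T by (intro sum_mono2) (auto simp: spread_nonneg)
  finally show ?thesis by (simp add: potential_def sum_divide_distrib)
qed

lemma negligible_UN:
  "finite I \<Longrightarrow> (\<And>i. i \<in> I \<Longrightarrow> negligible (f i)) \<Longrightarrow> negligible (\<Union>i\<in>I. f i)"
  by (intro negligible_Union finite_imageI) auto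

text \<open>Resolves the choice inside \<open>phi\<close>: a cell containing \<open>x\<close> exists
  because the cells cover the base simplex.\<close>

lemma phi_eq_bary_coords:
  fixes q :: "nat \<Rightarrow> 'a::euclidean_space"
  assumes nbs: "bary_nbs q t T" "nondegenerate q {0..DIM('a)}" and x: "x \<in> cell q {0..DIM('a)}"
  obtains V where "V \<in> T" "x \<in> cell q V" "phi q T x = bary_coords q V x"
proof -
  have ex: "\<exists>V. V \<in> T \<and> x \<in> cell q V"
    using bary_nbs_invariants[OF nbs] x by blast
  then have "phi q T x = bary_coords q (SOME V. V \<in> T \<and> x \<in> cell q V) x"
    unfolding phi_def by auto
  with someI_ex[OF ex] that show thesis by blast
qed

text \<open>All products are 0 or -\<infinity>, and a single -\<infinity> absorbs the whole sum. The
  product of -\<infinity> and 0 is 0 in \<open>ereal\<close>, as the convention for weights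
  demands.\<close>

lemma weighted_sum_nonneg_iff:
  fixes w :: "nat \<Rightarrow> ereal" and \<alpha> :: "nat \<Rightarrow> real"
  assumes w: "\<And>i. w i = 0 \<or> w i = -\<infinity>" and \<alpha>: "\<And>i. 0 \<le> \<alpha> i"
  shows "0 \<le> (\<Sum>i\<le>t. w i * ereal (\<alpha> i)) \<longleftrightarrow> (\<forall>i\<le>t. w i = -\<infinity> \<longrightarrow> \<alpha> i = 0)"
proof
  assume *: "\<forall>i\<le>t. w i = -\<infinity> \<longrightarrow> \<alpha> i = 0"
  have "(\<Sum>i\<le>t. w i * ereal (\<alpha> i)) = 0"
  proof (intro sum.neutral ballI)
    fix i assume "i \<in> {..t}"
    then show "w i * ereal (\<alpha> i) = 0"
      using * w[of i] by (cases "w i = 0") (auto simp: zero_ereal_def[symmetric])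
  qed
  then show "0 \<le> (\<Sum>i\<le>t. w i * ereal (\<alpha> i))" by simp
next
  assume nonneg: "0 \<le> (\<Sum>i\<le>t. w i * ereal (\<alpha> i))"
  have le: "w i * ereal (\<alpha> i) \<le> 0" for i
    using w[of i] \<alpha>[of i] by (cases "\<alpha> i = 0") (auto simp: zero_ereal_def[symmetric])
  show "\<forall>i\<le>t. w i = -\<infinity> \<longrightarrow> \<alpha> i = 0"
  proof (intro allI impI, rule ccontr)
    fix i assume i: "i \<le> t" "w i = -\<infinity>" "\<alpha> i \<noteq> 0"
    then have "w i * ereal (\<alpha> i) = -\<infinity>" using \<alpha>[of i] by simp
    moreover have "(\<Sum>i\<le>t. w i * ereal (\<alpha> i)) = w i * ereal (\<alpha> i) + (\<Sum>j\<in>{..t} - {i}. w j * ereal (\<alpha> j))"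
      using i(1) by (intro sum.remove) auto
    moreover have "(\<Sum>j\<in>{..t} - {i}. w j * ereal (\<alpha> j)) \<le> 0"
      using le by (intro sum_nonpos) auto
    ultimately have "(\<Sum>i\<le>t. w i * ereal (\<alpha> i)) = -\<infinity>" by auto
    with nonneg show False by simp
  qed
qed

theorem theorem2:
  fixes q :: "nat \<Rightarrow> 'a::euclidean_space" and S P :: "'a set" and \<epsilon> :: real
  assumes regular: "\<And>i j. i \<le> DIM('a) \<Longrightarrow> j \<le> DIM('a) \<Longrightarrow> i \<noteq> j \<Longrightarrow> dist (q i) (q j) = 1"
    and indep: "\<not> affine_dependent (q ` {0..DIM('a)})"
    and S_def: "S = convex hull (q ` {0..DIM('a)})"
    and P_sub: "P \<subseteq> S" and P_compact: "compact P" and P_convex: "convex P"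
    and P_int: "interior P \<noteq> {}" and P_diam: "diameter P = 1"
    and eps: "0 < \<epsilon>" "\<epsilon> < 1"
  shows "\<exists>q' t T (w :: nat \<Rightarrow> ereal).
           (\<forall>i\<le>DIM('a). q' i = q i) \<and> bary_nbs q' t T \<and> (\<forall>i\<le>t. w i \<noteq> \<infinity>) \<and>
           (let Pt = {x \<in> S. 0 \<le> (\<Sum>i\<le>t. w i * ereal (phi q' T x i))} in
              Pt - P \<in> sets lebesgue \<and>
              measure lebesgue (Pt - P) < \<epsilon> * measure lebesgue S \<and>
              inner_parallel Pt \<epsilon> \<subseteq> P \<and> P \<subseteq> Pt)"
proof -
  have "inj_on q {0..DIM('a)}"
    using regular by (intro inj_onI) (metis atLeastAtMost_iff dist_self zero_neq_one)
  then have nd: "nondegenerate q {0..DIM('a)}"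
    using indep by (simp add: nondegenerate_def)
  have "P \<noteq> {}" using P_int by auto
  have "S \<in> lmeasurable" "convex S"
    unfolding S_def by (simp_all add: lmeasurable_cell)
  moreover have "interior S \<noteq> {}" using interior_mono[OF P_sub] P_int by blast
  ultimately have S_pos: "0 < measure lebesgue S"
    using negligible_iff_measure[of S] negligible_convex_interior[of S] zero_less_measure_iff by blast
  \<comment> \<open>The first bound gives the volume estimate, the second forces the inner parallel
    body into \<open>P\<close>.\<close>
  define \<eta> where "\<eta> = min (\<epsilon> * measure lebesgue S) (measure lebesgue (cball (0::'a) (\<epsilon> / 2)))"
  have "0 < measure lebesgue (cball (0::'a) (\<epsilon> / 2))"
    using eps by (simp add: measure_completion content_cball)
  then have \<eta>: "0 < \<eta>" using S_pos eps by (simp add: \<eta>_def)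
  \<comment> \<open>Half of \<eta> is allotted to points within \<delta> of \<open>P\<close>, the
    other half to cells of spread at least \<open>\<delta>\<^sup>2\<close>; this fixes the bound on
    the potential below.\<close>
  obtain \<delta> where \<delta>: "\<delta> > 0" "measure lebesgue ({x. infdist x P \<le> \<delta>} - P) < \<eta> / 2"
    using measure_infdist_tube[OF P_compact \<open>P \<noteq> {}\<close>, of "\<eta> / 2"] \<eta> by auto
  obtain q0 t0 T0 where q0: "\<forall>i\<le>DIM('a). q0 i = q i" and nbs0: "bary_nbs q0 t0 T0"
    and pot: "potential q0 T0 < \<eta> / 2 * \<delta>\<^sup>2"
    using bary_nbs_small_potential[OF nd, of "\<eta> / 2 * \<delta>\<^sup>2"] \<eta> \<delta>(1) by auto
  have nd0: "nondegenerate q0 {0..DIM('a)}"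
    using nd q0 by (subst nondegenerate_cong[of _ _ q]) auto
  \<comment> \<open>Every cell of \<open>T0\<close> is split once more. As \<open>T0 - T0\<close> is
    empty, each cell of \<open>T\<close> has a vertex with index above \<open>t0\<close>.\<close>
  obtain q' t T par where q': "\<forall>i\<le>t0. q' i = q0 i" and nbs: "bary_nbs q' t T"
    and par: "\<forall>W\<in>T. \<forall>i\<in>W. t0 < i \<longrightarrow> par i \<in> T0 \<and> cell q' W \<subseteq> cell q0 (par i)"
    and new: "\<forall>W\<in>T. W \<in> T0 - T0 \<or> (\<exists>i\<in>W. t0 < i)"
    using bary_nbs_refine[OF nbs0 nd0 subset_refl] by (elim exE conjE)
  have agree: "\<forall>i\<le>DIM('a). q' i = q i"
    using q' q0 bary_nbs_dim_le[OF nbs0] by auto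
  then have nd': "nondegenerate q' {0..DIM('a)}"
    using nd by (subst nondegenerate_cong[of _ _ q]) auto
  have S: "S = cell q' {0..DIM('a)}"
    unfolding S_def using agree by (intro arg_cong[where f="\<lambda>X. convex hull X"] image_cong) auto
  have T: "finite T" "\<And>V. V \<in> T \<Longrightarrow> nondegenerate q' V" "\<And>V. V \<in> T \<Longrightarrow> finite V"
    "(\<Union>V\<in>T. cell q' V) = S" "pairwise (\<lambda>V W. negligible (cell q' V \<inter> cell q' W)) T"
    using bary_nbs_invariants[OF nbs nd'] nondegenerate_finite unfolding S by blast+
  define w :: "nat \<Rightarrow> ereal" where
    "w i = (if t0 < i \<and> cell q0 (par i) \<inter> P = {} then -\<infinity> else 0)" for i
  define Pt where "Pt = {x \<in> S. 0 \<le> (\<Sum>i\<le>t. w i * ereal (phi q' T x i))}"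
  \<comment> \<open>Outside this null set of overlaps and facets, a point of \<open>S\<close> lies
    in exactly one cell and has no vanishing coordinate there, so the choice in \<open>phi\<close>
    is forced.\<close>
  define N where "N = (\<Union>W\<in>T. \<Union>W'\<in>T - {W}. cell q' W \<inter> cell q' W') \<union> (\<Union>W\<in>T. \<Union>i\<in>W. cell q' (W - {i}))"
  \<comment> \<open>The finite union of cells without infinite weights serves as a measurable
    substitute for \<open>Pt\<close>.\<close>
  define A where "A = (\<Union>W\<in>{W \<in> T. \<forall>i\<in>W. w i = 0}. cell q' W)"
  have mem_Pt: "\<exists>V\<in>T. x \<in> cell q' V \<and> (x \<in> Pt \<longleftrightarrow> (\<forall>i\<in>V. w i = -\<infinity> \<longrightarrow> bary_coords q' V x i = 0))"
    if x: "x \<in> S" for x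
  proof -
    obtain V where V: "V \<in> T" "x \<in> cell q' V" "phi q' T x = bary_coords q' V x"
      using phi_eq_bary_coords[OF nbs nd'] x unfolding S by blast
    note c = bary_coords(1,2)[OF T(2)[OF V(1)] V(2)]
    have "0 \<le> bary_coords q' V x i" for i
      using c by (cases "i \<in> V") simp_all
    moreover have "w i = 0 \<or> w i = -\<infinity>" for i by (simp add: w_def)
    ultimately have "0 \<le> (\<Sum>i\<le>t. w i * ereal (bary_coords q' V x i)) \<longleftrightarrow>
        (\<forall>i\<le>t. w i = -\<infinity> \<longrightarrow> bary_coords q' V x i = 0)"
      by (intro weighted_sum_nonneg_iff)
    then have "x \<in> Pt \<longleftrightarrow> (\<forall>i\<le>t. w i = -\<infinity> \<longrightarrow> bary_coords q' V x i = 0)"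
      using x by (simp add: Pt_def V(3))
    also have "\<dots> \<longleftrightarrow> (\<forall>i\<in>V. w i = -\<infinity> \<longrightarrow> bary_coords q' V x i = 0)"
      using c(1) bary_nbs_vertices[OF nbs V(1)] by blast
    finally show ?thesis using V by blast
  qed
  have P_Pt: "P \<subseteq> Pt"
  proof
    fix x assume x: "x \<in> P"
    then obtain V where V: "V \<in> T" "x \<in> cell q' V"
      "x \<in> Pt \<longleftrightarrow> (\<forall>i\<in>V. w i = -\<infinity> \<longrightarrow> bary_coords q' V x i = 0)"
      using mem_Pt P_sub by blast
    \<comment> \<open>The cell into which a new vertex of \<open>V\<close> was placed contains the
      cell of \<open>V\<close>, hence \<open>x\<close>, and so meets \<open>P\<close>.\<close>
    have "w i \<noteq> -\<infinity>" if "i \<in> V" for i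
      using par V(1,2) that x by (auto simp: w_def)
    then show "x \<in> Pt" using V(3) by blast
  qed
  have neg: "negligible N"
  proof -
    have "negligible (cell q' W \<inter> cell q' W')" if "W \<in> T" "W' \<in> T - {W}" for W W'
      using T(5) that by (auto simp: pairwise_def)
    then have "negligible (\<Union>W\<in>T. \<Union>W'\<in>T - {W}. cell q' W \<inter> cell q' W')"
      by (intro negligible_UN T(1) finite_Diff)
    moreover have "negligible (\<Union>W\<in>T. \<Union>i\<in>W. cell q' (W - {i}))"
      by (intro negligible_UN T negligible_cell_facet)
    ultimately show ?thesis
      unfolding N_def by (rule negligible_Un)
  qed
  have Pt_A: "x \<in> Pt \<longleftrightarrow> x \<in> A" if x: "x \<in> S" "x \<notin> N" for x
  proof -
    obtain V where V: "V \<in> T" "x \<in> cell q' V"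
      "x \<in> Pt \<longleftrightarrow> (\<forall>i\<in>V. w i = -\<infinity> \<longrightarrow> bary_coords q' V x i = 0)"
      using mem_Pt x(1) by blast
    have "bary_coords q' V x i \<noteq> 0" if "i \<in> V" for i
      using bary_coords_zero[OF T(2)[OF V(1)] V(2) that] x(2) V(1) that by (auto simp: N_def)
    then have "x \<in> Pt \<longleftrightarrow> (\<forall>i\<in>V. w i = 0)"
      using V(3) by (auto simp: w_def)
    moreover have "x \<in> A \<longleftrightarrow> (\<forall>i\<in>V. w i = 0)"
    proof
      assume "x \<in> A"
      then obtain W where W: "W \<in> T" "\<forall>i\<in>W. w i = 0" "x \<in> cell q' W"
        unfolding A_def by blast
      have "W = V"
      proof (rule ccontr)
        assume "W \<noteq> V"
        then have "x \<in> N" using V(1,2) W(1,3) unfolding N_def by blast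
        with x(2) show False by simp
      qed
      with W(2) show "\<forall>i\<in>V. w i = 0" by simp
    qed (use V(1,2) in \<open>unfold A_def, blast\<close>)
    ultimately show ?thesis by simp
  qed
  have A_S: "A \<subseteq> S" unfolding A_def T(4)[symmetric] by blast
  have "A \<in> sets lebesgue"
    unfolding A_def using T(1,3) lmeasurable_cell by (intro sets.finite_UN) (auto simp: fmeasurable_def)
  moreover have "N \<in> sets lebesgue" "Pt \<inter> N \<in> sets lebesgue"
    using neg negligible_subset[OF neg, of "Pt \<inter> N"] negligible_imp_sets by auto
  ultimately have "(A - N) \<union> (Pt \<inter> N) \<in> sets lebesgue"
    by (intro sets.Un sets.Diff)
  \<comment> \<open>\<open>Pt\<close> agrees with \<open>A\<close> off \<open>N\<close>, and its
    part inside \<open>N\<close> is measurable because Lebesgue measure is complete.\<close>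
  moreover have "Pt = (A - N) \<union> (Pt \<inter> N)"
    using Pt_A A_S by (auto simp: Pt_def)
  ultimately have "Pt \<in> sets lebesgue" by argo
  then have meas: "Pt - P \<in> sets lebesgue"
    using lmeasurable_compact[OF P_compact] by (auto simp: fmeasurable_def)
  define L where "L = (\<Union>V\<in>{V \<in> T0. \<delta>\<^sup>2 \<le> spread q0 V}. cell q0 V)"
  have T0: "finite T0" "\<And>V. V \<in> T0 \<Longrightarrow> finite V"
    using bary_nbs_invariants[OF nbs0 nd0] nondegenerate_finite by blast+
  define B where "B = {x. infdist x P \<le> \<delta>} - P"
  \<comment> \<open>A cell in \<open>A\<close> lies in a cell of \<open>T0\<close> that meets
    \<open>P\<close>. If that larger cell has small spread, it is within \<delta> of
    \<open>P\<close>; otherwise it belongs to \<open>L\<close>.\<close>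
  have A_sub: "A - P \<subseteq> B \<union> L"
  proof
    fix x assume "x \<in> A - P"
    then obtain W where W: "W \<in> T" "\<forall>i\<in>W. w i = 0" "x \<in> cell q' W" "x \<notin> P" by (auto simp: A_def)
    from new W(1) obtain i where i: "i \<in> W" "t0 < i" by blast
    with par W(1,3) have V: "par i \<in> T0" "x \<in> cell q0 (par i)" by auto
    have "w i = 0" using W(2) i(1) by blast
    with i(2) have "cell q0 (par i) \<inter> P \<noteq> {}" by (auto simp: w_def split: if_splits)
    then obtain y where y: "y \<in> cell q0 (par i)" "y \<in> P" by blast
    show "x \<in> B \<union> L"
    proof (cases "spread q0 (par i) < \<delta>\<^sup>2")
      case True
      then have "dist x y < \<delta>"
        using dist_less_if_spread_less[OF T0(2)[OF V(1)] V(2) y(1) True \<delta>(1)] by simp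
      then have "infdist x P \<le> \<delta>" using infdist_le[OF y(2), of x] by simp
      then show ?thesis using W(4) by (simp add: B_def)
    next
      case False
      then show ?thesis using V by (auto simp: L_def)
    qed
  qed
  have B_lm: "B \<in> lmeasurable"
    unfolding B_def using P_compact \<open>P \<noteq> {}\<close> \<delta>(1)
    by (intro fmeasurable.Diff lmeasurable_compact compact_infdist_le)
  have L_lm: "L \<in> lmeasurable"
    unfolding L_def using T0 by (intro fmeasurable.finite_UN lmeasurable_cell) auto
  have N_lm: "N \<in> lmeasurable" "measure lebesgue N = 0"
    using neg by (simp_all add: negligible_imp_measurable negligible_imp_measure0)
  have sub: "Pt - P \<subseteq> B \<union> L \<union> N"
    using A_sub Pt_A by (auto simp: Pt_def)
  have Pt_lm: "Pt - P \<in> lmeasurable"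
    using fmeasurableI2[OF _ sub meas] B_lm L_lm N_lm(1) by blast
  have "measure lebesgue (Pt - P) \<le> measure lebesgue (B \<union> L \<union> N)"
    using sub meas B_lm L_lm N_lm(1) by (intro measure_mono_fmeasurable) auto
  also have "\<dots> \<le> measure lebesgue B + measure lebesgue L + measure lebesgue N"
    using measure_Un_le[of "B \<union> L" lebesgue N] measure_Un_le[of B lebesgue L] B_lm L_lm N_lm(1)
    by (auto simp: fmeasurable_def)
  also have "\<dots> < \<eta>"
  proof -
    have "measure lebesgue L \<le> potential q0 T0 / \<delta>\<^sup>2"
      unfolding L_def by (rule measure_large_spread[OF T0 \<delta>(1)])
    also have "\<dots> < \<eta> / 2" using pot \<delta>(1) by (simp add: pos_divide_less_eq)
    finally show ?thesis using \<delta>(2) N_lm(2) by (simp add: B_def)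
  qed
  finally have small: "measure lebesgue (Pt - P) < \<eta>" .
  then have "measure lebesgue (Pt - P) < \<epsilon> * measure lebesgue S"
    "inner_parallel Pt \<epsilon> \<subseteq> P"
    using inner_parallel_subset_if_small_measure[OF compact_imp_closed[OF P_compact] P_convex eps(1) Pt_lm]
    by (simp_all add: \<eta>_def)
  moreover have "\<forall>i\<le>t. w i \<noteq> \<infinity>" by (simp add: w_def)
  ultimately show ?thesis
    using agree nbs meas P_Pt unfolding Pt_def Let_def
    by (intro exI[of _ q'] exI[of _ t] exI[of _ T] exI[of _ w] conjI)
qed

end
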